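(* Let $\mathfrak{L}:=\mathbb{F}e$ be the one-dimensional Lie algebra over a field $\mathbb{F}$, and let $M$ be a Leibniz $\mathfrak{L}$-bimodule. Then, as $\mathbb{F}$-vector spaces, $$\mathrm{HL}^n(\mathfrak{L},M)\cong\begin{cases} M^{\mathfrak{L}} & \text{if }n=0, \\ {M^0}/{M\mathfrak{L}} & \text{if }n\text{ is odd}, \\ {M^{\mathfrak{L}}}/{M_0} & \text{if }n\text{ is even and }n\neq 0 \end{cases}$$ for every non-negative integer $n$, where $M^0:=\{m\in M\mid e\cdot m+m\cdot e=0\}$. Moreover, if $M$ is finite-dimensional, then $M^0/M\mathfrak{L}\cong M^{\mathfrak{L}}/M_0$ as $\mathbb{F}$-vector spaces.
   Context: A left Leibniz algebra over a field $\mathbb{F}$ is an $\mathbb{F}$-vector space $\mathfrak{L}$ with a bilinear multiplication satisfying $x(yz)=(xy)z+y(xz)$ for all $x,y,z\in\mathfrak{L}$; every Lie algebra is one (here $ee=0$). An $\mathfrak{L}$-bimodule (Leibniz bimodule) is an $\mathbb{F}$-vector space $M$ with bilinear left and right actions of $\mathfrak{L}$ such that $(xy)\cdot m=x\cdot(y\cdot m)-y\cdot(x\cdot m)$, $(x\cdot m)\cdot y=x\cdot(m\cdot y)-m\cdot(xy)$, and $(m\cdot x)\cdot y=m\cdot(xy)-x\cdot(m\cdot y)$ for all $m\in M$, $x,y\in\mathfrak{L}$. Notation: $M^{\mathfrak{L}}:=\{m\in M\mid m\cdot x=0\text{ for all }x\in\mathfrak{L}\}$; $M\mathfrak{L}:=\langle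 m\cdot x\mid m\in M,x\in\mathfrak{L}\rangle_{\mathbb{F}}$; $M_0:=\langle x\cdot m+m\cdot x\mid x\in\mathfrak{L},m\in M\rangle_{\mathbb{F}}$. (In this setting $M\mathfrak{L}\subseteq M^0$ and $M_0\subseteq M^{\mathfrak{L}}$.) Leibniz cohomology: for $n\ge 0$ let $\mathrm{CL}^n(\mathfrak{L},M):=\mathrm{Hom}_{\mathbb{F}}(\mathfrak{L}^{\otimes n},M)$ and $\mathrm{d}^n:\mathrm{CL}^n(\mathfrak{L},M)\to\mathrm{CL}^{n+1}(\mathfrak{L},M)$, $$(\mathrm{d}^nf)(x_1\otimes\dots\otimes x_{n+1})=\sum_{j=1}^n(-1)^{j+1}x_j\cdot f(x_1\otimes\dots\otimes\hat{x}_j\otimes\dots\otimes x_{n+1})+(-1)^{n+1}f(x_1\otimes\dots\otimes x_n)\cdot x_{n+1}+\sum_{1\le i<j\le n+1}(-1)^if(x_1\otimes\dots\otimes\hat{x}_i\otimes\dots\otimes x_{j-1}\otimes x_ix_j\otimes x_{j+1}\otimes\dots\otimes x_{n+1}).$$ This is a cochain complex, and $\mathrm{HL}^n(\mathfrak{L},M):=\operatorname{Ker}(\mathrm{d}^n)/\operatorname{Im}(\mathrm{d}^{n-1})$ with $\mathrm{d}^{-1}:=0$. *)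

theory Defs
  imports Complex_Main "HOL-Library.Function_Algebras" "HOL-Library.Set_Algebras"
begin

definition bilinear_map ::
  "('f::field \<Rightarrow> 'a::ab_group_add \<Rightarrow> 'a) \<Rightarrow> ('f \<Rightarrow> 'b::ab_group_add \<Rightarrow> 'b) \<Rightarrow>
   ('f \<Rightarrow> 'c::ab_group_add \<Rightarrow> 'c) \<Rightarrow> ('a \<Rightarrow> 'b \<Rightarrow> 'c) \<Rightarrow> bool" where
  "bilinear_map s1 s2 s3 b \<longleftrightarrow>
     (\<forall>x. Vector_Spaces.linear s2 s3 (\<lambda>y. b x y)) \<and>
     (\<forall>y. Vector_Spaces.linear s1 s3 (\<lambda>x. b x y))"

locale left_leibniz_algebra = vector_space sL
  for sL :: "'f::field \<Rightarrow> 'l::ab_group_add \<Rightarrow> 'l" +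
  fixes mul :: "'l \<Rightarrow> 'l \<Rightarrow> 'l"
  assumes bilinear_mul: "bilinear_map sL sL sL mul"
    and leibniz: "mul x (mul y z) = mul (mul x y) z + mul y (mul x z)"

locale lie_algebra = vector_space sL
  for sL :: "'f::field \<Rightarrow> 'l::ab_group_add \<Rightarrow> 'l" +
  fixes mul :: "'l \<Rightarrow> 'l \<Rightarrow> 'l"
  assumes bilinear_mul: "bilinear_map sL sL sL mul"
    and alternating: "mul x x = 0"
    and jacobi: "mul x (mul y z) + mul y (mul z x) + mul z (mul x y) = 0"
begin

lemma mul_add_left: "mul (x + y) z = mul x z + mul y z"
proof -
  interpret Vector_Spaces.linear sL sL "\<lambda>x. mul x z"
    using bilinear_mul by (simp add: bilinear_map_def)
  show ?thesis by (rule add)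
qed

lemma mul_add_right: "mul x (y + z) = mul x y + mul x z"
proof -
  interpret Vector_Spaces.linear sL sL "\<lambda>y. mul x y"
    using bilinear_mul by (simp add: bilinear_map_def)
  show ?thesis by (rule add)
qed

lemma mul_minus_right: "mul x (- y) = - mul x y"
proof -
  interpret Vector_Spaces.linear sL sL "\<lambda>y. mul x y"
    using bilinear_mul by (simp add: bilinear_map_def)
  show ?thesis by (rule neg)
qed

lemma antisymmetric: "mul x y = - mul y x"
proof -
  have "mul x y + mul y x = 0"
    using alternating[of "x + y"]
    by (simp only: mul_add_left mul_add_right alternating[of x] alternating[of y]
        add_0_left add_0_right add.commute)
  then show ?thesis by (rule add_eq_0_iff2[THEN iffD1])
qed

sublocale left_leibniz_algebra sL mul
proof unfold_locales
  show "bilinear_map sL sL sL mul" by (rule bilinear_mul)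
  show "mul x (mul y z) = mul (mul x y) z + mul y (mul x z)" for x y z
  proof -
    have "mul (mul x y) z = - mul z (mul x y)" by (rule antisymmetric)
    moreover have "mul y (mul x z) = - mul y (mul z x)"
      using antisymmetric[of x z] by (simp add: mul_minus_right)
    moreover have "mul x (mul y z) = - (mul y (mul z x) + mul z (mul x y))"
      using jacobi[of x y z] by (simp only: add.assoc add_eq_0_iff2)
    ultimately show ?thesis by (simp only: minus_add)
  qed
qed

end

locale leibniz_bimodule =
  left_leibniz_algebra sL mul + M: vector_space sM
  for sL :: "'f::field \<Rightarrow> 'l::ab_group_add \<Rightarrow> 'l"
    and mul :: "'l \<Rightarrow> 'l \<Rightarrow> 'l"
    and sM :: "'f \<Rightarrow> 'm::ab_group_add \<Rightarrow> 'm" +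
  fixes la :: "'l \<Rightarrow> 'm \<Rightarrow> 'm"
    and ra :: "'m \<Rightarrow> 'l \<Rightarrow> 'm"
  assumes bilinear_la: "bilinear_map sL sM sM la"
    and bilinear_ra: "bilinear_map sM sL sM ra"
    and LLM: "la (mul x y) m = la x (la y m) - la y (la x m)"
    and LML: "ra (la x m) y = la x (ra m y) - ra m (mul x y)"
    and MLL: "ra (ra m x) y = ra m (mul x y) - la x (ra m y)"

text \<open>
  With \<open>la x m\<close> and \<open>ra m x\<close> the left and right action, the next four sets are
  \<open>M\<^sup>L\<close>, \<open>ML\<close>, \<open>M\<^sub>0\<close> and \<open>M\<^sup>0\<close>; the last one depends on the chosen element \<open>e\<close>.
\<close>

definition right_invariants :: "('m::ab_group_add \<Rightarrow> 'l \<Rightarrow> 'm) \<Rightarrow> 'm set" where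
  "right_invariants ra = {m. \<forall>x. ra m x = 0}"

definition right_image ::
  "('f::field \<Rightarrow> 'm::ab_group_add \<Rightarrow> 'm) \<Rightarrow> ('m \<Rightarrow> 'l \<Rightarrow> 'm) \<Rightarrow> 'm set" where
  "right_image sM ra = module.span sM {ra m x | m x. True}"

definition antisym_kernel ::
  "('f::field \<Rightarrow> 'm::ab_group_add \<Rightarrow> 'm) \<Rightarrow> ('l \<Rightarrow> 'm \<Rightarrow> 'm) \<Rightarrow> ('m \<Rightarrow> 'l \<Rightarrow> 'm) \<Rightarrow> 'm set" where
  "antisym_kernel sM la ra = module.span sM {la x m + ra m x | x m. True}"

definition antisym_elements ::
  "('l \<Rightarrow> 'm::ab_group_add \<Rightarrow> 'm) \<Rightarrow> ('m \<Rightarrow> 'l \<Rightarrow> 'm) \<Rightarrow> 'l \<Rightarrow> 'm set" where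
  "antisym_elements la ra e = {m. la e m + ra m e = 0}"

text \<open>
  A vector space is given by its carrier and its scalar multiplication; the addition is
  the one of the type class. For the cosets forming a quotient \<open>A / B\<close> this is the
  addition of sets from \<open>Set_Algebras\<close>, which on cosets of a subspace is the usual one, and
  scalar multiplication adds \<open>B\<close> so that \<open>0\<close> times a coset is \<open>B\<close> rather than \<open>{0}\<close>.
\<close>

type_synonym ('f, 'v) vspace = "'v set \<times> ('f \<Rightarrow> 'v \<Rightarrow> 'v)"

definition quotient_space ::
  "('f \<Rightarrow> 'v::ab_group_add \<Rightarrow> 'v) \<Rightarrow> 'v set \<Rightarrow> 'v set \<Rightarrow> ('f, 'v set) vspace" where
  "quotient_space s A B = ((\<lambda>a. a +o B) ` A, \<lambda>c X. s c ` X + B)"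

definition vspace_iso :: "('f, 'v::plus) vspace \<Rightarrow> ('f, 'w::plus) vspace \<Rightarrow> bool" where
  "vspace_iso V W \<longleftrightarrow> (\<exists>\<phi>. bij_betw \<phi> (fst V) (fst W) \<and>
     (\<forall>x\<in>fst V. \<forall>y\<in>fst V. \<phi> (x + y) = \<phi> x + \<phi> y) \<and>
     (\<forall>c. \<forall>x\<in>fst V. \<phi> (snd V c x) = snd W c (\<phi> x)))"

lemma (in vector_space) coset_operations:
  assumes "subspace B"
  shows "(x +o B) + (y +o B) = (x + y) +o B"
    and "scale c ` (x +o B) + B = scale c x +o B"
proof -
  have "0 \<in> B" and "B + B = B"
    using assms by (force simp: set_plus_def subspace_def)+
  then show "(x +o B) + (y +o B) = (x + y) +o B"
    by (simp add: set_plus_rearrange)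
  show "scale c ` (x +o B) + B = scale c x +o B"
  proof (intro set_eqI iffI)
    fix z assume "z \<in> scale c ` (x +o B) + B"
    then obtain u v where "u \<in> B" "v \<in> B" "z = scale c (x + u) + v"
      by (auto simp: set_plus_def elt_set_plus_def)
    then have "z = scale c x + (scale c u + v)" "scale c u + v \<in> B"
      using assms by (auto simp: subspace_def scale_right_distrib add.assoc)
    then show "z \<in> scale c x +o B" by (auto simp: elt_set_plus_def)
  next
    fix z assume "z \<in> scale c x +o B"
    then obtain v where "v \<in> B" "z = scale c (x + 0) + v" by (auto simp: elt_set_plus_def)
    then show "z \<in> scale c ` (x +o B) + B"
      using \<open>0 \<in> B\<close> unfolding set_plus_def elt_set_plus_def by blast
  qed
qed

text \<open>
  \<open>Hom(L\<^sup>\<otimes>\<^sup>n, M)\<close> is represented by the \<open>n\<close>-linear maps, a tensor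
  \<open>x\<^sub>1 \<otimes> \<dots> \<otimes> x\<^sub>n\<close> being the list of its factors. Cochains are functions on all lists, so
  they are made unique by vanishing on lists of the wrong length.
\<close>

definition cochains ::
  "('f::field \<Rightarrow> 'l::ab_group_add \<Rightarrow> 'l) \<Rightarrow> ('f \<Rightarrow> 'm::ab_group_add \<Rightarrow> 'm) \<Rightarrow> nat \<Rightarrow>
   ('l list \<Rightarrow> 'm) set" where
  "cochains sL sM n = {f.
     (\<forall>xs i. length xs = n \<longrightarrow> i < n \<longrightarrow> Vector_Spaces.linear sL sM (\<lambda>x. f (xs[i := x]))) \<and>
     (\<forall>xs. length xs \<noteq> n \<longrightarrow> f xs = 0)}"

definition omit_nth :: "nat \<Rightarrow> 'a list \<Rightarrow> 'a list" where
  "omit_nth i xs = take i xs @ drop (Suc i) xs"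

text \<open>
  List positions start at \<open>0\<close>: the summation indices \<open>i\<close> and \<open>j\<close> below are the
  mathematical ones decreased by one, which shifts the exponents of the first and the third sign.
\<close>

definition leibniz_d ::
  "('l \<Rightarrow> 'l \<Rightarrow> 'l) \<Rightarrow> ('f::field \<Rightarrow> 'm::ab_group_add \<Rightarrow> 'm) \<Rightarrow> ('l \<Rightarrow> 'm \<Rightarrow> 'm) \<Rightarrow> ('m \<Rightarrow> 'l \<Rightarrow> 'm) \<Rightarrow>
   nat \<Rightarrow> ('l list \<Rightarrow> 'm) \<Rightarrow> ('l list \<Rightarrow> 'm)" where
  "leibniz_d mul sM la ra n f = (\<lambda>xs. if length xs = n + 1 then
       (\<Sum>j<n. sM ((- 1) ^ j) (la (xs ! j) (f (omit_nth j xs))))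
     + sM ((- 1) ^ (n + 1)) (ra (f (take n xs)) (xs ! n))
     + (\<Sum>j\<le>n. \<Sum>i<j. sM ((- 1) ^ (i + 1)) (f (omit_nth i (xs[j := mul (xs ! i) (xs ! j)]))))
     else 0)"

definition cocycles where
  "cocycles sL mul sM la ra n = {f \<in> cochains sL sM n. leibniz_d mul sM la ra n f = 0}"

definition coboundaries where
  "coboundaries sL mul sM la ra n =
     (case n of 0 \<Rightarrow> {0} | Suc k \<Rightarrow> leibniz_d mul sM la ra k ` cochains sL sM k)"

definition HL ::
  "('f::field \<Rightarrow> 'l::ab_group_add \<Rightarrow> 'l) \<Rightarrow> ('l \<Rightarrow> 'l \<Rightarrow> 'l) \<Rightarrow> ('f \<Rightarrow> 'm::ab_group_add \<Rightarrow> 'm) \<Rightarrow>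
   ('l \<Rightarrow> 'm \<Rightarrow> 'm) \<Rightarrow> ('m \<Rightarrow> 'l \<Rightarrow> 'm) \<Rightarrow> nat \<Rightarrow> ('f, ('l list \<Rightarrow> 'm) set) vspace" where
  "HL sL mul sM la ra n =
     quotient_space (\<lambda>c f xs. sM c (f xs))
       (cocycles sL mul sM la ra n) (coboundaries sL mul sM la ra n)"

end

theory Submission
  imports Defs
begin

text \<open>
  An \<open>n\<close>-cochain is determined by its value on \<open>e \<otimes> \<dots> \<otimes> e\<close>, so the \<open>n\<close>-th cochain space is a copy
  of \<open>M\<close>. As \<open>ee = 0\<close>, the bracket terms of the differential vanish, and the signs of the left
  action alternate; under the identification with \<open>M\<close> the differential in degree \<open>n\<close> becomes
  \<open>m \<mapsto> - m \<cdot> e\<close> for even \<open>n\<close> and \<open>m \<mapsto> e \<cdot> m + m \<cdot> e\<close> for odd \<open>n\<close>, whose kernels and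
  images are the four subspaces of the theorem. If \<open>M\<close> is finite-dimensional, the rank-nullity
  theorem for these two endomorphisms shows that the two quotients have the same dimension.
\<close>

section \<open>Isomorphisms between quotient spaces\<close>

lemma vspace_iso_trans:
  assumes "vspace_iso U V" "vspace_iso V W"
  shows "vspace_iso U W"
proof -
  obtain \<phi> where \<phi>: "bij_betw \<phi> (fst U) (fst V)"
      "\<forall>x\<in>fst U. \<forall>y\<in>fst U. \<phi> (x + y) = \<phi> x + \<phi> y"
      "\<forall>c. \<forall>x\<in>fst U. \<phi> (snd U c x) = snd V c (\<phi> x)"
    using assms(1) unfolding vspace_iso_def by blast
  obtain \<psi> where \<psi>: "bij_betw \<psi> (fst V) (fst W)"
      "\<forall>x\<in>fst V. \<forall>y\<in>fst V. \<psi> (x + y) = \<psi> x + \<psi> y"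
      "\<forall>c. \<forall>x\<in>fst V. \<psi> (snd V c x) = snd W c (\<psi> x)"
    using assms(2) unfolding vspace_iso_def by blast
  show ?thesis
    unfolding vspace_iso_def
    using \<phi> \<psi> bij_betw_trans[OF \<phi>(1) \<psi>(1)] bij_betwE[OF \<phi>(1)]
    by (intro exI[of _ "\<psi> \<circ> \<phi>"]) auto
qed

text \<open>Cosets of \<open>{0}\<close> are singletons, so \<open>the_elem\<close> is the
  isomorphism. This serves degree 0, where the answer is a subspace and not a quotient.\<close>

lemma vspace_iso_quotient_zero: "vspace_iso (quotient_space s A {0}) (A, s)"
proof -
  have coset: "a +o {0} = {a}" for a :: 'a
    by (auto simp: elt_set_plus_def)
  show ?thesis
    unfolding vspace_iso_def quotient_space_def coset
    by (intro exI[of _ the_elem])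
      (auto simp: bij_betw_def inj_on_def image_image set_plus_def)
qed

lemma (in vector_space) coset_eq_iff:
  assumes "subspace B"
  shows "x +o B = y +o B \<longleftrightarrow> x - y \<in> B"
proof
  assume "x +o B = y +o B"
  moreover have "x \<in> x +o B"
    using subspace_0[OF assms] by (force simp: elt_set_plus_def)
  ultimately show "x - y \<in> B"
    by (auto simp: elt_set_plus_def)
next
  assume *: "x - y \<in> B"
  have "z - y \<in> B \<longleftrightarrow> z - x \<in> B" for z
    using subspace_add[OF assms, of "z - x" "x - y"] subspace_diff[OF assms, of "z - y" "x - y"] *
    by auto
  moreover have "z \<in> w +o B \<longleftrightarrow> z - w \<in> B" for z w
    by (force simp: elt_set_plus_def)
  ultimately show "x +o B = y +o B"
    by blast
qed

text \<open>A form of the first isomorphism theorem: \<open>fB\<close> lets \<open>f\<close> pass to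
  cosets, \<open>ker\<close> makes the induced map injective and \<open>onto\<close> makes it
  surjective. Since \<open>onto\<close> is required only modulo \<open>B'\<close>, a map onto a
  complement of \<open>B'\<close> qualifies.\<close>

lemma (in Vector_Spaces.linear) vspace_iso_quotient:
  assumes A: "vs1.subspace A" and B: "vs1.subspace B" and B': "vs2.subspace B'"
    and le: "f ` A \<subseteq> A'" and onto: "A' \<subseteq> f ` A + B'"
    and fB: "f ` B \<subseteq> B'" and ker: "\<And>a. a \<in> A \<Longrightarrow> f a \<in> B' \<Longrightarrow> a \<in> B"
  shows "vspace_iso (quotient_space s1 A B) (quotient_space s2 A' B')"
proof -
  \<comment> \<open>The image of a coset of \<open>B\<close> may be a proper part of a coset of
    \<open>B'\<close>; adding \<open>B'\<close> fills it up, without a choice of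
    representatives.\<close>
  define \<phi> where "\<phi> X = f ` X + B'" for X
  have \<phi>: "\<phi> (a +o B) = f a +o B'" for a
  proof (intro set_eqI iffI)
    fix z assume "z \<in> \<phi> (a +o B)"
    then obtain b b' where "b \<in> B" "b' \<in> B'" "z = f (a + b) + b'"
      by (auto simp: \<phi>_def set_plus_def elt_set_plus_def)
    moreover from this have "f b + b' \<in> B'"
      using fB B' by (auto intro: vs2.subspace_add)
    ultimately show "z \<in> f a +o B'"
      by (auto simp: elt_set_plus_def add add.assoc)
  next
    fix z assume "z \<in> f a +o B'"
    then obtain b' where "b' \<in> B'" "z = f (a + 0) + b'"
      by (auto simp: elt_set_plus_def)
    then show "z \<in> \<phi> (a +o B)"
      using vs1.subspace_0[OF B] unfolding \<phi>_def set_plus_def elt_set_plus_def by blast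
  qed
  have "inj_on \<phi> ((\<lambda>a. a +o B) ` A)"
  proof (rule inj_onI; clarify)
    fix a a' assume a: "a \<in> A" "a' \<in> A" "\<phi> (a +o B) = \<phi> (a' +o B)"
    then have "f (a - a') \<in> B'"
      by (simp add: \<phi> vs2.coset_eq_iff[OF B'] diff)
    then show "a +o B = a' +o B"
      using a ker[of "a - a'"] vs1.subspace_diff[OF A] by (simp add: vs1.coset_eq_iff[OF B])
  qed
  moreover have "\<phi> ` (\<lambda>a. a +o B) ` A = (\<lambda>a. a +o B') ` A'"
  proof -
    have "a' +o B' \<in> (\<lambda>a. f a +o B') ` A" if a': "a' \<in> A'" for a'
    proof -
      obtain a b' where a: "a \<in> A" "b' \<in> B'" "a' = f a + b'"
        using onto a' by (blast elim: set_plus_elim)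
      then have "a' +o B' = f a +o B'"
        by (simp add: vs2.coset_eq_iff[OF B'])
      with a show ?thesis by blast
    qed
    then show ?thesis using le by (auto simp: image_image \<phi>)
  qed
  ultimately have "bij_betw \<phi> ((\<lambda>a. a +o B) ` A) ((\<lambda>a. a +o B') ` A')"
    by (simp add: bij_betw_def)
  then show ?thesis
    unfolding vspace_iso_def quotient_space_def
    by (intro exI[of _ \<phi>])
      (auto simp: vs1.coset_operations[OF B] vs2.coset_operations[OF B'] \<phi> add scale)
qed

section \<open>Dimension counting\<close>

context finite_dimensional_vector_space
begin

text \<open>A basis \<open>b\<close> of \<open>V\<close> is extended to one of \<open>U\<close>. The
  added vectors \<open>c\<close> span a complement of \<open>V\<close>, which stands in for the
  quotient in both arguments below.\<close>

lemma relative_basis: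
  assumes U: "subspace U" and V: "subspace V" and "V \<subseteq> U"
  obtains b c where "finite c" "independent (b \<union> c)" "b \<inter> c = {}"
    "span b = V" "span (b \<union> c) = U" "card c + dim V = dim U"
proof -
  obtain b where b: "b \<subseteq> V" "independent b" "V \<subseteq> span b" "card b = dim V"
    using basis_exists by blast
  obtain a where a: "b \<subseteq> a" "a \<subseteq> U" "independent a" "U \<subseteq> span a"
    using maximal_independent_subset_extend[of b U] b \<open>V \<subseteq> U\<close> by blast
  have fin: "finite a" using a finiteI_independent by auto
  have "card (a - b) + card b = card a"
    using fin a(1) by (metis card_Diff_subset card_mono finite_subset le_add_diff_inverse2)
  moreover have "card a = dim U"
    using basis_card_eq_dim a by blast
  moreover have "span b = V" "span a = U"
    using a b U V span_minimal by blast+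
  moreover have "b \<union> (a - b) = a" using a by blast
  ultimately show ?thesis
    using fin a b by (intro that[of "a - b" b]) auto
qed

text \<open>A complement of the kernel is mapped bijectively onto the range.\<close>

lemma rank_nullity:
  assumes f: "Vector_Spaces.linear scale scale f"
  shows "dim (range f) + dim {x. f x = 0} = dim UNIV"
proof -
  interpret f: Vector_Spaces.linear scale scale f by (rule f)
  interpret pair: finite_dimensional_vector_space_pair_1 scale Basis scale ..
  obtain b c where bc: "finite c" "independent (b \<union> c)" "b \<inter> c = {}"
      "span b = {x. f x = 0}" "span (b \<union> c) = UNIV" "card c + dim {x. f x = 0} = dim UNIV"
    using relative_basis[OF subspace_UNIV f.subspace_kernel subset_UNIV] by metis
  \<comment> \<open>The projection onto \<open>span c\<close> along the kernel of \<open>f\<close>.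
    A vector of \<open>span c\<close> in the kernel is both fixed and killed by \<open>p\<close>,
    hence zero; this gives injectivity on \<open>span c\<close>.\<close>
  obtain p where p: "Vector_Spaces.linear scale scale p"
      "\<forall>x\<in>b \<union> c. p x = (if x \<in> b then 0 else x)"
    using pair.linear_independent_extend[OF bc(2), of "\<lambda>x. if x \<in> b then 0 else x"] by blast
  interpret p: Vector_Spaces.linear scale scale p by (rule p)
  have pb: "p x = 0" if "x \<in> span b" for x
    using p.eq_0_on_span[OF _ that] p(2) by auto
  have pc: "p x = x" if "x \<in> span c" for x
  proof (rule pair.linear_eq_on[OF p(1) linear_ident that])
    show "p y = y" if "y \<in> c" for y
      using that p(2) bc(3) by auto
  qed
  have "range f = f ` span c"
  proof -
    have "f x \<in> f ` span c" for x
    proof -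
      have "x \<in> span (b \<union> c)" using bc(5) by simp
      then obtain v u where "v \<in> span b" "u \<in> span c" "x = v + u"
        unfolding span_Un by blast
      then show ?thesis using bc(4) by (simp add: f.add)
    qed
    then show ?thesis by auto
  qed
  moreover have "inj_on f (span c)"
  proof -
    have "u = 0" if "u \<in> span c" "f u = 0" for u
      using that pb[of u] pc[of u] bc(4) by simp
    then show ?thesis
      using f.inj_on_iff_eq_0[OF subspace_span] by blast
  qed
  ultimately have "dim (range f) = dim c"
    using pair.dim_image_eq[OF f, of c] by (simp add: f.span_image[symmetric] dim_span)
  also have "\<dots> = card c"
    using dim_eq_card_independent independent_mono[OF bc(2), of c] by blast
  finally show ?thesis
    using bc(6) by simp
qed

text \<open>Complements of \<open>B\<close> in \<open>A\<close> and of \<open>B'\<close> in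
  \<open>A'\<close> have bases of equal size. A bijection between these, extended by zero on
  \<open>B\<close>, induces the isomorphism. The dimension hypothesis is additive to avoid
  subtraction of naturals.\<close>

lemma quotient_iso_if_dim_eq:
  assumes A: "subspace A" and B: "subspace B" and "B \<subseteq> A"
    and A': "subspace A'" and B': "subspace B'" and "B' \<subseteq> A'"
    and dim: "dim A + dim B' = dim A' + dim B"
  shows "vspace_iso (quotient_space scale A B) (quotient_space scale A' B')"
proof -
  interpret pair: vector_space_pair scale scale ..
  obtain b c where bc: "finite c" "independent (b \<union> c)" "b \<inter> c = {}" "span b = B"
      "span (b \<union> c) = A" "card c + dim B = dim A"
    using relative_basis[OF A B \<open>B \<subseteq> A\<close>] by blast
  obtain b' c' where bc': "finite c'" "independent (b' \<union> c')" "b' \<inter> c' = {}" "span b' = B'"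
      "span (b' \<union> c') = A'" "card c' + dim B' = dim A'"
    using relative_basis[OF A' B' \<open>B' \<subseteq> A'\<close>] by blast
  have "card c = card c'" using bc(6) bc'(6) dim by linarith
  then obtain h where h: "bij_betw h c c'"
    using bc(1) bc'(1) finite_same_card_bij by blast
  obtain g where g: "Vector_Spaces.linear scale scale g"
      "\<forall>x\<in>b \<union> c. g x = (if x \<in> b then 0 else h x)"
    using pair.linear_independent_extend[OF bc(2), of "\<lambda>x. if x \<in> b then 0 else h x"] by blast
  \<comment> \<open>\<open>g'\<close> undoes \<open>g\<close> on \<open>span c\<close> and kills
    \<open>B'\<close>. So if u in \<open>span c\<close> has \<open>g u\<close> in \<open>B'\<close>,
    then u = \<open>g' (g u)\<close> = 0, which is the injectivity modulo \<open>B\<close>.\<close>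
  obtain g' where g': "Vector_Spaces.linear scale scale g'"
      "\<forall>x\<in>b' \<union> c'. g' x = (if x \<in> b' then 0 else inv_into c h x)"
    using pair.linear_independent_extend[OF bc'(2), of "\<lambda>x. if x \<in> b' then 0 else inv_into c h x"] by blast
  interpret g: Vector_Spaces.linear scale scale g by (rule g)
  interpret g': Vector_Spaces.linear scale scale g' by (rule g')
  have gb: "g x = 0" if "x \<in> span b" for x
    using g.eq_0_on_span[OF _ that] g(2) by auto
  have gb': "g' x = 0" if "x \<in> span b'" for x
    using g'.eq_0_on_span[OF _ that] g'(2) by auto
  have gh: "g x = h x" if "x \<in> c" for x
    using that g(2) bc(3) by auto
  have g'h: "g' x = inv_into c h x" if "x \<in> c'" for x
    using that g'(2) bc'(3) by auto
  have "g' (g x) = x" if "x \<in> c" for x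
    using that h by (simp add: gh g'h bij_betwE bij_betw_inv_into_left)
  then have g'g: "g' (g x) = x" if "x \<in> span c" for x
    using pair.linear_eq_on[OF Vector_Spaces.linear_compose[OF g(1) g'(1)] linear_ident that] by simp
  have gc: "g ` span c = span c'"
    using gh h by (simp add: g.span_image[symmetric] bij_betw_def)
  have A_eq: "A = span b + span c"
    using bc(5) unfolding span_Un by (auto simp: set_plus_def)
  have A'_eq: "A' = span c' + span b'"
    using bc'(5) unfolding span_Un by (force simp: set_plus_def add.commute)
  have gA: "g ` A = span c'"
  proof -
    have "g ` A = g ` span c"
      unfolding A_eq using gb span_zero[of b]
      by (fastforce simp: set_plus_def g.add image_iff)
    then show ?thesis using gc by simp
  qed
  show ?thesis
  proof (rule g.vspace_iso_quotient[OF A B B'])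
    show "g ` A \<subseteq> A'"
      using gA bc'(5) span_mono[of c' "b' \<union> c'"] by auto
    show "A' \<subseteq> g ` A + B'"
      unfolding gA A'_eq bc'(4) by simp
    show "g ` B \<subseteq> B'"
      using gb bc(4) subspace_0[OF B'] by auto
    fix a assume "a \<in> A" "g a \<in> B'"
    then obtain v u where vu: "v \<in> span b" "u \<in> span c" "a = v + u"
      by (auto simp: A_eq set_plus_def)
    then have "g u \<in> B'" using \<open>g a \<in> B'\<close> gb by (simp add: g.add)
    then have "u = 0" using g'g[OF vu(2)] gb' bc'(4) by simp
    then show "a \<in> B" using vu bc(4) by simp
  qed
qed

end

section \<open>Bimodules over a one-dimensional Lie algebra\<close>

locale one_dimensional_bimodule = lie_algebra sL mul + leibniz_bimodule sL mul sM la ra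
  for sL :: "'f::field \<Rightarrow> 'l::ab_group_add \<Rightarrow> 'l"
    and mul :: "'l \<Rightarrow> 'l \<Rightarrow> 'l"
    and sM :: "'f \<Rightarrow> 'm::ab_group_add \<Rightarrow> 'm"
    and la :: "'l \<Rightarrow> 'm \<Rightarrow> 'm"
    and ra :: "'m \<Rightarrow> 'l \<Rightarrow> 'm" +
  fixes e :: 'l
  assumes generator_nonzero: "e \<noteq> 0"
    and span_generator: "span {e} = UNIV"
begin

lemma linear_la_right: "Vector_Spaces.linear sM sM (la x)"
  and linear_la_left: "Vector_Spaces.linear sL sM (\<lambda>x. la x m)"
  using bilinear_la by (auto simp: bilinear_map_def)

lemma linear_ra_left: "Vector_Spaces.linear sM sM (\<lambda>m. ra m x)"
  and linear_ra_right: "Vector_Spaces.linear sL sM (ra m)"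
  using bilinear_ra by (auto simp: bilinear_map_def)

sublocale L: Vector_Spaces.linear sM sM "la e"
  by (rule linear_la_right)

sublocale R: Vector_Spaces.linear sM sM "\<lambda>m. ra m e"
  by (rule linear_ra_left)

text \<open>The linear form dual to the basis \<open>{e}\<close>.\<close>

definition coord :: "'l \<Rightarrow> 'f" where
  "coord x = representation {e} x e"

lemma independent_generator: "independent {e}"
  using generator_nonzero by (simp add: dependent_single)

sublocale coord: Vector_Spaces.linear sL "(*)" coord
  unfolding coord_def using independent_generator span_generator by (rule linear_representation)

lemma coord_generator: "coord e = 1"
  using independent_generator by (simp add: coord_def representation_basis)

lemma scale_coord: "sL (coord x) e = x"
  using sum_representation_eq[OF independent_generator, of x "{e}"] span_generator
  by (simp add: coord_def)

lemma mul_zero: "mul x y = 0"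
proof -
  have "mul x y = mul (sL (coord x) e) (sL (coord y) e)"
    by (simp add: scale_coord)
  also have "\<dots> = sL (coord x) (sL (coord y) (mul e e))"
  proof -
    interpret l: Vector_Spaces.linear sL sL "\<lambda>x. mul x (sL (coord y) e)"
      using bilinear_mul by (simp add: bilinear_map_def)
    interpret r: Vector_Spaces.linear sL sL "mul e"
      using bilinear_mul by (simp add: bilinear_map_def)
    show ?thesis by (simp add: l.scale r.scale)
  qed
  finally show ?thesis by (simp add: alternating)
qed

lemma la_coord: "la x m = sM (coord x) (la e m)"
proof -
  interpret Vector_Spaces.linear sL sM "\<lambda>x. la x m" by (rule linear_la_left)
  show ?thesis using scale[of "coord x" e] by (simp add: scale_coord)
qed

lemma ra_coord: "ra m x = sM (coord x) (ra m e)"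
proof -
  interpret Vector_Spaces.linear sL sM "ra m" by (rule linear_ra_right)
  show ?thesis using scale[of "coord x" e] by (simp add: scale_coord)
qed

text \<open>For x = y = e, \<open>LML\<close> and \<open>MLL\<close> have opposite right-hand sides.
  This is the inclusion of \<open>M\<^sub>0\<close> in \<open>M\<^sup>L\<close>.\<close>

lemma ra_la_plus_ra: "ra (la e m + ra m e) e = 0"
  using LML[of e m e] MLL[of m e e] mul_zero[of e e] linear_ra_right
  by (simp add: R.add)

text \<open>This is \<open>MLL\<close> at x = y = e with ee = 0; it yields the inclusion of ML in
  \<open>M\<^sup>0\<close>.\<close>

lemma la_plus_ra_ra: "la e (ra m e) + ra (ra m e) e = 0"
  using MLL[of m e e] mul_zero[of e e] module_hom.zero[OF module_hom_linearI[OF linear_ra_right]]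
  by simp

section \<open>Cochains and the differential in terms of M\<close>

text \<open>
  \<open>d_value n\<close> is the differential in degree \<open>n\<close> transported to \<open>M\<close> along \<open>cochain_of\<close>.
\<close>

definition cochain_of :: "nat \<Rightarrow> 'm \<Rightarrow> 'l list \<Rightarrow> 'm" where
  "cochain_of n m = (\<lambda>xs. if length xs = n then sM (prod_list (map coord xs)) m else 0)"

definition d_value :: "nat \<Rightarrow> 'm \<Rightarrow> 'm" where
  "d_value n m = (if even n then - ra m e else la e m + ra m e)"

lemma cochain_of_generator: "cochain_of n m (replicate n e) = m"
  by (simp add: cochain_of_def coord_generator)

lemma cochain_of_mem: "cochain_of n m \<in> cochains sL sM n"
proof -
  have "Vector_Spaces.linear sL sM (\<lambda>x. cochain_of n m (xs[i := x]))"
    if "length xs = n" "i < n" for xs i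
  proof -
    \<comment> \<open>The coordinate of the i-th entry splits off as a factor; the remaining vector
      does not depend on x.\<close>
    have "cochain_of n m (xs[i := x]) =
        sM (coord x) (sM (prod_list (map coord (omit_nth i xs))) m)" for x
      using that by (simp add: cochain_of_def omit_nth_def upd_conv_take_nth_drop mult.left_commute)
    moreover have "Vector_Spaces.linear sL sM (\<lambda>x. sM (coord x) w)" for w
      by (simp add: Vector_Spaces.linear_iff vector_space_axioms M.vector_space_axioms
          coord.add coord.scale M.scale_left_distrib)
    ultimately show ?thesis
      by (simp only:)
  qed
  then show ?thesis
    by (auto simp: cochains_def cochain_of_def)
qed

lemma cochain_eq:
  assumes f: "f \<in> cochains sL sM n"
  shows "f = cochain_of n (f (replicate n e))"
proof
  \<comment> \<open>Linearity in one slot at a time: the head x of the list gives the factor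
    \<open>coord x\<close> and is replaced by \<open>e\<close>, which then joins the prefix
    \<open>ys\<close>. Hence the induction keeps \<open>ys\<close> arbitrary.\<close>
  have step: "f (ys @ xs) = sM (prod_list (map coord xs)) (f (ys @ replicate (length xs) e))"
    if "length ys + length xs = n" for xs ys
    using that
  proof (induction xs arbitrary: ys)
    case (Cons x xs)
    have "Vector_Spaces.linear sL sM (\<lambda>x. f (zs[i := x]))" if "length zs = n" "i < n" for zs i
      using f that by (simp add: cochains_def)
    from this[of "ys @ x # xs" "length ys"]
    have lin: "Vector_Spaces.linear sL sM (\<lambda>z. f (ys @ z # xs))"
      using Cons.prems by simp
    have "f (ys @ x # xs) = sM (coord x) (f (ys @ e # xs))"
      using module_hom.scale[OF module_hom_linearI[OF lin], of "coord x" e]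
      by (simp add: scale_coord)
    then show ?case
      using Cons.IH[of "ys @ [e]"] Cons.prems by simp
  qed simp
  show "f xs = cochain_of n (f (replicate n e)) xs" for xs
    using f step[of "[]" xs] by (auto simp: cochain_of_def cochains_def)
qed

lemma cochains_eq: "cochains sL sM n = range (cochain_of n)"
  using cochain_of_mem cochain_eq by blast

text \<open>The n left-action terms of the differential agree up to sign, so this sum decides
  whether they cancel or leave one term.\<close>

lemma sum_alternating: "(\<Sum>j<n. (- 1) ^ j) = (if even n then 0 else 1 :: 'f)"
  by (induction n) auto

lemma leibniz_d_cochain_of:
  "leibniz_d mul sM la ra n (cochain_of n m) = cochain_of (n + 1) (d_value n m)"
proof
  fix xs :: "'l list"
  show "leibniz_d mul sM la ra n (cochain_of n m) xs = cochain_of (n + 1) (d_value n m) xs"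
  proof (cases "length xs = n + 1")
    case True
    \<comment> \<open>All n + 1 coordinates enter \<open>p\<close>: n come from the cochain, and the
      entry removed from its argument contributes the last one through its action.\<close>
    define p where "p = prod_list (map coord xs)"
    have left: "la (xs ! j) (cochain_of n m (omit_nth j xs)) = sM p (la e m)" if "j < n" for j
    proof -
      have "p = coord (xs ! j) * prod_list (map coord (omit_nth j xs))"
        using that True unfolding p_def omit_nth_def
        by (subst id_take_nth_drop[of j xs]) (simp_all add: mult.left_commute)
      then show ?thesis
        using that True by (simp add: la_coord[of "xs ! j"] cochain_of_def omit_nth_def L.scale)
    qed
    have right: "ra (cochain_of n m (take n xs)) (xs ! n) = sM p (ra m e)"
    proof -
      have "p = coord (xs ! n) * prod_list (map coord (take n xs))"
        using True unfolding p_def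
        by (subst id_take_nth_drop[of n xs]) (simp_all add: mult.commute)
      then show ?thesis
        using True by (simp add: ra_coord[of _ "xs ! n"] cochain_of_def R.scale)
    qed
    have bracket: "cochain_of n m (omit_nth i (xs[j := mul (xs ! i) (xs ! j)])) = 0"
      if "i < j" "j \<le> n" for i j
    proof -
      \<comment> \<open>The product puts 0 at position j, and since i < j, removing position i keeps
        that 0.\<close>
      have "0 \<in> set (omit_nth i (xs[j := 0]))"
        using that True by (simp add: omit_nth_def drop_update_swap set_update_memI)
      then have "prod_list (map coord (omit_nth i (xs[j := 0]))) = 0"
        by (force simp: prod_list_zero_iff coord.zero)
      then show ?thesis by (simp add: mul_zero cochain_of_def)
    qed
    have "leibniz_d mul sM la ra n (cochain_of n m) xs =
        (\<Sum>j<n. sM ((- 1) ^ j) (sM p (la e m))) + sM ((- 1) ^ (n + 1)) (sM p (ra m e))"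
      using True by (simp add: leibniz_d_def left right bracket)
    also have "\<dots> = sM p (d_value n m)"
      unfolding M.scale_sum_left[symmetric] sum_alternating d_value_def
      by (simp add: M.scale_right_distrib)
    finally show ?thesis
      using True by (simp add: cochain_of_def p_def)
  qed (simp add: leibniz_d_def cochain_of_def)
qed

lemma cochain_of_eq_0_iff: "cochain_of n m = 0 \<longleftrightarrow> m = 0"
proof
  assume "cochain_of n m = 0"
  then show "m = 0" using cochain_of_generator[of n m] by (simp add: zero_fun_def)
qed (auto simp: cochain_of_def)

lemma cocycles_eq: "cocycles sL mul sM la ra n = cochain_of n ` {m. d_value n m = 0}"
  unfolding cocycles_def cochains_eq by (auto simp: leibniz_d_cochain_of cochain_of_eq_0_iff)

lemma coboundaries_0: "coboundaries sL mul sM la ra 0 = cochain_of 0 ` {0}"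
  using cochain_of_eq_0_iff[of 0 0] by (simp add: coboundaries_def)

lemma coboundaries_Suc:
  "coboundaries sL mul sM la ra (Suc n) = cochain_of (Suc n) ` range (d_value n)"
  by (simp add: coboundaries_def cochains_eq image_image leibniz_d_cochain_of)

lemma linear_d_value: "Vector_Spaces.linear sM sM (d_value n)"
  by (simp add: Vector_Spaces.linear_iff M.vector_space_axioms d_value_def
      L.add R.add L.scale R.scale M.scale_right_distrib)

section \<open>Transport of cohomology to quotients inside M\<close>

lemma vector_space_functions: "vector_space (\<lambda>c f xs. sM c (f xs))"
  by unfold_locales
    (auto simp: fun_eq_iff M.scale_right_distrib M.scale_left_distrib)

lemma linear_cochain_of: "Vector_Spaces.linear sM (\<lambda>c f xs. sM c (f xs)) (cochain_of n)"
  by (auto simp: Vector_Spaces.linear_iff M.vector_space_axioms vector_space_functions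
      cochain_of_def fun_eq_iff M.scale_right_distrib mult.commute)

lemma linear_apply: "Vector_Spaces.linear (\<lambda>c f xs. sM c (f xs)) sM (\<lambda>f. f ys)"
  by (simp add: Vector_Spaces.linear_iff M.vector_space_axioms vector_space_functions)

text \<open>Evaluation at the list of n copies of \<open>e\<close> is a left inverse of
  \<open>cochain_of n\<close> and is linear on all functions on lists, so it induces the
  isomorphism.\<close>

lemma vspace_iso_cochain_quotient:
  assumes A: "M.subspace A" and B: "M.subspace B"
  shows "vspace_iso (quotient_space (\<lambda>c f xs. sM c (f xs)) (cochain_of n ` A) (cochain_of n ` B))
    (quotient_space sM A B)"
proof -
  interpret c: Vector_Spaces.linear sM "\<lambda>c f xs. sM c (f xs)" "cochain_of n"
    by (rule linear_cochain_of)
  interpret ev: Vector_Spaces.linear "\<lambda>c f xs. sM c (f xs)" sM "\<lambda>f. f (replicate n e)"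
    by (rule linear_apply)
  show ?thesis
  proof (rule ev.vspace_iso_quotient[OF c.subspace_image[OF A] c.subspace_image[OF B] B])
    show "A \<subseteq> (\<lambda>f. f (replicate n e)) ` cochain_of n ` A + B"
      using M.subspace_0[OF B]
      by (force simp: image_image cochain_of_generator set_plus_def)
  qed (auto simp: cochain_of_generator)
qed

section \<open>The four subspaces as kernels and ranges\<close>

lemma right_invariants_eq: "right_invariants ra = {m. ra m e = 0}"
  unfolding right_invariants_def by (auto, metis ra_coord M.scale_zero_right)

text \<open>The scalar \<open>coord x\<close> can be moved from x into m, so the spanning set is
  already the range of a linear map.\<close>

lemma right_image_eq: "right_image sM ra = range (\<lambda>m. ra m e)"
proof -
  have "{ra m x | m x. True} = range (\<lambda>m. ra m e)"
    using ra_coord by (auto simp: R.scale[symmetric])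
  moreover have "M.subspace (range (\<lambda>m. ra m e))"
    using R.subspace_image[OF M.subspace_UNIV] .
  ultimately show ?thesis
    by (simp add: right_image_def M.span_eq_iff)
qed

lemma antisym_kernel_eq: "antisym_kernel sM la ra = range (\<lambda>m. la e m + ra m e)"
proof -
  have "la x m + ra m x = la e (sM (coord x) m) + ra (sM (coord x) m) e" for x m
    using la_coord[of x m] ra_coord[of m x] by (simp add: L.scale R.scale)
  then have "{la x m + ra m x | x m. True} = range (\<lambda>m. la e m + ra m e)"
    by auto
  \<comment> \<open>The map in question is \<open>d_value 1\<close>, whose linearity is
    known.\<close>
  moreover have "M.subspace (range (\<lambda>m. la e m + ra m e))"
    using module_hom.subspace_image[OF module_hom_linearI[OF linear_d_value[of 1]] M.subspace_UNIV]
    by (simp add: d_value_def)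
  ultimately show ?thesis
    by (simp add: antisym_kernel_def M.span_eq_iff)
qed

lemma kernel_d_value:
  "{m. d_value n m = 0} = (if even n then right_invariants ra else antisym_elements la ra e)"
  by (auto simp: d_value_def right_invariants_eq antisym_elements_def)

lemma range_d_value:
  "range (d_value n) = (if even n then right_image sM ra else antisym_kernel sM la ra)"
proof (cases "even n")
  case True
  \<comment> \<open>Replacing m by -m absorbs the sign in \<open>d_value\<close>.\<close>
  have "- ra m e = ra (- m) e" for m
    by (simp add: R.neg)
  then have "range (\<lambda>m. - ra m e) = range (\<lambda>m. ra m e)"
    by (auto simp: image_iff) (metis add.inverse_inverse)
  then show ?thesis
    using True by (simp add: d_value_def[abs_def] right_image_eq)
qed (simp add: d_value_def[abs_def] antisym_kernel_eq)

lemma subspace_kernel_d_value: "M.subspace {m. d_value n m = 0}"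
  by (rule module_hom.subspace_kernel[OF module_hom_linearI[OF linear_d_value]])

lemma subspace_range_d_value: "M.subspace (range (d_value n))"
  by (rule module_hom.subspace_image[OF module_hom_linearI[OF linear_d_value] M.subspace_UNIV])

section \<open>Cohomology in each degree and periodicity\<close>

lemma HL_0: "vspace_iso (HL sL mul sM la ra 0) (right_invariants ra, sM)"
proof -
  have "vspace_iso (HL sL mul sM la ra 0) (quotient_space sM (right_invariants ra) {0})"
    using vspace_iso_cochain_quotient[OF subspace_kernel_d_value[of 0] M.subspace_single_0, of 0]
    unfolding HL_def cocycles_eq coboundaries_0 by (simp only: kernel_d_value even_zero if_True)
  then show ?thesis
    using vspace_iso_quotient_zero by (rule vspace_iso_trans)
qed

lemma HL_Suc: "vspace_iso (HL sL mul sM la ra (Suc n))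
    (quotient_space sM {m. d_value (Suc n) m = 0} (range (d_value n)))"
  unfolding HL_def cocycles_eq coboundaries_Suc
  by (rule vspace_iso_cochain_quotient[OF subspace_kernel_d_value subspace_range_d_value])

text \<open>The two parities are \<open>ra_la_plus_ra\<close> and \<open>la_plus_ra_ra\<close>. It
  supplies the inclusions of ranges in kernels for the dimension count.\<close>

lemma d_value_d_value: "d_value (Suc n) (d_value n m) = 0"
  using ra_la_plus_ra la_plus_ra_ra[of m] by (auto simp: d_value_def L.neg R.neg add_eq_0_iff)

lemma periodicity_if_finite_dimensional:
  assumes "finite_dimensional_vector_space sM B"
  shows "vspace_iso (quotient_space sM (antisym_elements la ra e) (right_image sM ra))
    (quotient_space sM (right_invariants ra) (antisym_kernel sM la ra))"
proof -
  interpret fd: finite_dimensional_vector_space sM B by (rule assms)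
  \<comment> \<open>Only the parity of the degree matters to \<open>d_value\<close>, so degree 2
    counts as degree 0.\<close>
  have "range (d_value 0) \<subseteq> {m. d_value 1 m = 0}" "range (d_value 1) \<subseteq> {m. d_value 0 m = 0}"
    using d_value_d_value[of 0] d_value_d_value[of 1] by (auto simp: d_value_def)
  \<comment> \<open>By rank-nullity both sides equal dim M. Kernel and range of the same map stand
    on the same side, whereas each quotient pairs the kernel of one map with the range of the
    other.\<close>
  moreover have "M.dim {m. d_value 1 m = 0} + M.dim (range (d_value 1))
      = M.dim {m. d_value 0 m = 0} + M.dim (range (d_value 0))"
    using fd.rank_nullity[OF linear_d_value[of 0]] fd.rank_nullity[OF linear_d_value[of 1]] by simp
  ultimately have "vspace_iso (quotient_space sM {m. d_value 1 m = 0} (range (d_value 0)))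
      (quotient_space sM {m. d_value 0 m = 0} (range (d_value 1)))"
    by (intro fd.quotient_iso_if_dim_eq subspace_kernel_d_value subspace_range_d_value)
  then show ?thesis
    by (simp add: kernel_d_value range_d_value)
qed

end

theorem theorem4p3:
  fixes sL :: "'f::field \<Rightarrow> 'l::ab_group_add \<Rightarrow> 'l"
    and mul :: "'l \<Rightarrow> 'l \<Rightarrow> 'l"
    and e :: 'l
    and sM :: "'f \<Rightarrow> 'm::ab_group_add \<Rightarrow> 'm"
    and la :: "'l \<Rightarrow> 'm \<Rightarrow> 'm"
    and ra :: "'m \<Rightarrow> 'l \<Rightarrow> 'm"
  assumes lie: "lie_algebra sL mul"
    and one_dimensional: "e \<noteq> 0" "module.span sL {e} = UNIV"
    and bimodule: "leibniz_bimodule sL mul sM la ra"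
  shows "(\<forall>n.
      (n = 0 \<longrightarrow> vspace_iso (HL sL mul sM la ra n) (right_invariants ra, sM)) \<and>
      (odd n \<longrightarrow> vspace_iso (HL sL mul sM la ra n)
         (quotient_space sM (antisym_elements la ra e) (right_image sM ra))) \<and>
      (even n \<and> n \<noteq> 0 \<longrightarrow> vspace_iso (HL sL mul sM la ra n)
         (quotient_space sM (right_invariants ra) (antisym_kernel sM la ra)))) \<and>
    ((\<exists>B. finite_dimensional_vector_space sM B) \<longrightarrow>
      vspace_iso (quotient_space sM (antisym_elements la ra e) (right_image sM ra))
        (quotient_space sM (right_invariants ra) (antisym_kernel sM la ra)))"
proof -
  interpret lie_algebra sL mul by (rule lie)
  interpret leibniz_bimodule sL mul sM la ra by (rule bimodule)
  interpret one_dimensional_bimodule sL mul sM la ra e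
    using one_dimensional by unfold_locales
  \<comment> \<open>For n > 0 the kernel has the parity of n and the range that of n - 1, which
    selects the two subspaces.\<close>
  have "vspace_iso (HL sL mul sM la ra n)
      (quotient_space sM (antisym_elements la ra e) (right_image sM ra))" if "odd n" for n
    using that HL_Suc[of "n - 1"] by (cases n) (simp_all add: kernel_d_value range_d_value)
  moreover have "vspace_iso (HL sL mul sM la ra n)
      (quotient_space sM (right_invariants ra) (antisym_kernel sM la ra))"
    if "even n" "n \<noteq> 0" for n
    using that HL_Suc[of "n - 1"] by (cases n) (simp_all add: kernel_d_value range_d_value)
  ultimately show ?thesis
    using HL_0 periodicity_if_finite_dimensional by blast
qed

end
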